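(* Let $C$ be a group with commensurated subgroups $A_1$ and $A_2$, at least one of which is finitely generated. Then $\{[A_1],[A_2]\}$ has a least upper bound $[A_1]\vee[A_2]$ in the poset $\mathrm{S}(C)/\!\sim$, and $[A_1]\vee[A_2]$ consists of commensurated subgroups of $C$. Moreover one can find $A$ such that $[A]=[A_1]\vee[A_2]$ of the form $A=\langle A_1, A_2\cap A\rangle$. In particular, if $A_1$ and $A_2$ are both finitely generated, then so is $A$.
   Context: Two subgroups of a group are commensurable if their intersection has finite index in each of them. A subgroup $H$ of a group $C$ is commensurated in $C$ if $H$ and $cHc^{-1}$ are commensurable for every $c\in C$. $H$ is virtually contained in $B$ if some finite index subgroup of $H$ is contained in $B$. $\mathrm{S}(C)$ is the set of subgroups of $C$, $[H]$ denotes the commensurability class of a subgroup $H$ of $C$ (all subgroups of $C$ commensurable with $H$), and $\mathrm{S}(C)/\!\sim$ is the set of commensurability classes, partially ordered by $[A_1]\preccurlyeq[A_2]$ iff $A_1$ is virtually contained in $A_2$. *)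

theory Defs
  imports "HOL-Algebra.Generated_Groups" "HOL-Algebra.Order"
begin

definition finite_index_in :: "('a, 'b) monoid_scheme \<Rightarrow> 'a set \<Rightarrow> 'a set \<Rightarrow> bool" where
  "finite_index_in G K H \<longleftrightarrow>
     subgroup K (G\<lparr>carrier := H\<rparr>) \<and> finite (rcosets\<^bsub>G\<lparr>carrier := H\<rparr>\<^esub> K)"

definition commensurable :: "('a, 'b) monoid_scheme \<Rightarrow> 'a set \<Rightarrow> 'a set \<Rightarrow> bool" where
  "commensurable G H K \<longleftrightarrow> finite_index_in G (H \<inter> K) H \<and> finite_index_in G (H \<inter> K) K"

definition commensurated :: "('a, 'b) monoid_scheme \<Rightarrow> 'a set \<Rightarrow> bool" where
  "commensurated G H \<longleftrightarrow> subgroup H G \<and>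
     (\<forall>c\<in>carrier G. commensurable G H ((c <#\<^bsub>G\<^esub> H) #>\<^bsub>G\<^esub> inv\<^bsub>G\<^esub> c))"

definition virtually_contained :: "('a, 'b) monoid_scheme \<Rightarrow> 'a set \<Rightarrow> 'a set \<Rightarrow> bool" where
  "virtually_contained G H B \<longleftrightarrow> (\<exists>K. finite_index_in G K H \<and> K \<subseteq> B)"

definition finitely_generated :: "('a, 'b) monoid_scheme \<Rightarrow> 'a set \<Rightarrow> bool" where
  "finitely_generated G H \<longleftrightarrow> (\<exists>S. finite S \<and> S \<subseteq> carrier G \<and> H = generate G S)"

definition commensurability_rel :: "('a, 'b) monoid_scheme \<Rightarrow> ('a set \<times> 'a set) set" where
  "commensurability_rel G =
     {(H, K). subgroup H G \<and> subgroup K G \<and> commensurable G H K}"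

definition comm_class :: "('a, 'b) monoid_scheme \<Rightarrow> 'a set \<Rightarrow> 'a set set" where
  "comm_class G H = commensurability_rel G `` {H}"

text \<open>The order on classes is defined through some choice of representatives; the lemma
  \<open>comm_poset_le_iff\<close> below shows that it does not depend on that choice.\<close>

definition comm_poset :: "('a, 'b) monoid_scheme \<Rightarrow> 'a set set gorder" where
  "comm_poset G =
     \<lparr>carrier = {H. subgroup H G} // commensurability_rel G,
      eq = (=),
      le = (\<lambda>P Q. \<exists>H\<in>P. \<exists>K\<in>Q. virtually_contained G H K)\<rparr>"

lemma finite_image_factor:
  assumes "finite (f ` A)" and "\<And>a b. a \<in> A \<Longrightarrow> b \<in> A \<Longrightarrow> f a = f b \<Longrightarrow> g a = g b"
  shows "finite (g ` A)"
proof -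
  have "g ` A \<subseteq> (\<lambda>y. g (inv_into A f y)) ` (f ` A)"
  proof
    fix z assume "z \<in> g ` A"
    then obtain a where a: "a \<in> A" "z = g a" by blast
    have "g (inv_into A f (f a)) = g a"
      using a(1) by (intro assms(2)) (auto intro: inv_into_into f_inv_into_f)
    then show "z \<in> (\<lambda>y. g (inv_into A f y)) ` (f ` A)" using a by (metis imageI)
  qed
  with assms(1) show ?thesis by (rule finite_surj)
qed

context group
begin

lemma finite_index_in_iff:
  assumes "subgroup H G"
  shows "finite_index_in G K H \<longleftrightarrow> subgroup K G \<and> K \<subseteq> H \<and> finite ((\<lambda>a. K #> a) ` H)"
proof -
  have "rcosets\<^bsub>G\<lparr>carrier := H\<rparr>\<^esub> K = (\<lambda>a. K #> a) ` H"
    unfolding RCOSETS_def r_coset_def by auto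
  moreover have "subgroup K (G\<lparr>carrier := H\<rparr>) \<longleftrightarrow> subgroup K G \<and> K \<subseteq> H"
    using incl_subgroup[OF assms] subgroup_incl[OF _ assms] subgroup.subset[of K "G\<lparr>carrier := H\<rparr>"]
    by auto
  ultimately show ?thesis by (simp add: finite_index_in_def)
qed

lemma r_coset_eq_iff:
  assumes "subgroup K G" "a \<in> carrier G" "b \<in> carrier G"
  shows "K #> a = K #> b \<longleftrightarrow> a \<otimes> inv b \<in> K"
proof
  assume "K #> a = K #> b"
  then have "a \<in> K #> b" using rcos_self assms by blast
  then show "a \<otimes> inv b \<in> K"
    using assms subgroup.rcos_module_imp[OF assms(1) is_group] by blast
next
  assume "a \<otimes> inv b \<in> K"
  then have "a \<in> K #> b"
    using assms subgroup.rcos_module_rev[OF assms(1) is_group] by blast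
  then show "K #> a = K #> b" using repr_independence assms by metis
qed

lemma finite_index_in_refl: "subgroup H G \<Longrightarrow> finite_index_in G H H"
proof -
  assume H: "subgroup H G"
  have "(\<lambda>a. H #> a) ` H \<subseteq> {H}"
    using coset_join2[OF subgroup.mem_carrier[OF H] H] by auto
  then show ?thesis using H finite_index_in_iff finite_subset by blast
qed

lemma finite_index_in_Int:
  assumes "subgroup H G" "subgroup M G" "M \<subseteq> H" "finite_index_in G K H"
  shows "finite_index_in G (K \<inter> M) M"
proof -
  have K: "subgroup K G" and fin: "finite ((\<lambda>a. K #> a) ` H)"
    using assms finite_index_in_iff by auto
  have KM: "subgroup (K \<inter> M) G" using K assms(2) by (rule subgroups_Inter_pair)
  have "finite ((\<lambda>a. K #> a) ` M)" using fin assms(3) by (meson finite_subset image_mono)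
  then have "finite ((\<lambda>a. (K \<inter> M) #> a) ` M)"
  proof (rule finite_image_factor)
    fix a b assume ab: "a \<in> M" "b \<in> M" "K #> a = K #> b"
    have c: "a \<in> carrier G" "b \<in> carrier G" using ab subgroup.mem_carrier[OF assms(2)] by auto
    have "a \<otimes> inv b \<in> K" using r_coset_eq_iff[OF K c] ab by simp
    moreover have "a \<otimes> inv b \<in> M"
      using ab assms(2) by (simp add: subgroup.m_closed subgroup.m_inv_closed)
    ultimately show "(K \<inter> M) #> a = (K \<inter> M) #> b" using r_coset_eq_iff[OF KM c] by simp
  qed
  then show ?thesis using finite_index_in_iff[OF assms(2)] KM by blast
qed

lemma finite_index_in_trans:
  assumes H: "subgroup H G" and KH: "finite_index_in G K H" and LK: "finite_index_in G L K"
  shows "finite_index_in G L H"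
proof -
  have K: "subgroup K G" "K \<subseteq> H" and fK: "finite ((\<lambda>a. K #> a) ` H)"
    using KH finite_index_in_iff[OF H] by auto
  have L: "subgroup L G" "L \<subseteq> K" and fL: "finite ((\<lambda>a. L #> a) ` K)"
    using LK finite_index_in_iff[OF K(1)] by auto
  obtain T where T: "T \<subseteq> H" "finite T" "(\<lambda>a. K #> a) ` H = (\<lambda>a. K #> a) ` T"
    using finite_subset_image[OF fK order_refl] by auto
  have "(\<lambda>a. L #> a) ` H \<subseteq> (\<lambda>(X, t). X #> t) ` (((\<lambda>a. L #> a) ` K) \<times> T)"
  proof
    fix X assume "X \<in> (\<lambda>a. L #> a) ` H"
    then obtain a where a: "a \<in> H" "X = L #> a" by blast
    obtain t where t: "t \<in> T" "K #> a = K #> t" using T(3) a(1) by blast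
    have c: "a \<in> carrier G" "t \<in> carrier G" using a t T subgroup.mem_carrier[OF H] by auto
    have k: "a \<otimes> inv t \<in> K" using r_coset_eq_iff[OF K(1) c] t by simp
    have "(L #> (a \<otimes> inv t)) #> t = L #> ((a \<otimes> inv t) \<otimes> t)"
      using c subgroup.subset[OF L(1)] by (simp add: coset_mult_assoc)
    also have "(a \<otimes> inv t) \<otimes> t = a" using c by (simp add: m_assoc)
    finally show "X \<in> (\<lambda>(X, t). X #> t) ` (((\<lambda>a. L #> a) ` K) \<times> T)"
      using a k t by (intro image_eqI[where x = "(L #> (a \<otimes> inv t), t)"]) auto
  qed
  then have "finite ((\<lambda>a. L #> a) ` H)"
    by (rule finite_subset) (use fL T(2) in blast)
  then show ?thesis using finite_index_in_iff[OF H] K L by blast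
qed

lemma finite_index_in_mono:
  assumes H: "subgroup H G" and LH: "finite_index_in G L H"
    and K: "subgroup K G" "L \<subseteq> K" "K \<subseteq> H"
  shows "finite_index_in G K H"
proof -
  have L: "subgroup L G" and fL: "finite ((\<lambda>a. L #> a) ` H)"
    using LH finite_index_in_iff[OF H] by auto
  have "finite ((\<lambda>a. K #> a) ` H)"
    using fL
  proof (rule finite_image_factor)
    fix a b assume ab: "a \<in> H" "b \<in> H" "L #> a = L #> b"
    then have c: "a \<in> carrier G" "b \<in> carrier G" using subgroup.mem_carrier[OF H] by auto
    show "K #> a = K #> b"
      using r_coset_eq_iff[OF L c] r_coset_eq_iff[OF K(1) c] ab K(2) by blast
  qed
  then show ?thesis using finite_index_in_iff[OF H] K by blast
qed

lemma virtually_contained_iff: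
  assumes "subgroup H G" "subgroup B G"
  shows "virtually_contained G H B \<longleftrightarrow> finite_index_in G (H \<inter> B) H"
proof
  assume "virtually_contained G H B"
  then obtain K where K: "finite_index_in G K H" "K \<subseteq> B"
    unfolding virtually_contained_def by blast
  then have "K \<subseteq> H \<inter> B" using finite_index_in_iff[OF assms(1)] by blast
  then show "finite_index_in G (H \<inter> B) H"
    using finite_index_in_mono[OF assms(1) K(1) subgroups_Inter_pair[OF assms]] by blast
next
  assume "finite_index_in G (H \<inter> B) H"
  then show "virtually_contained G H B" unfolding virtually_contained_def by blast
qed

lemma virtually_contained_trans:
  assumes A: "subgroup A G" and B: "subgroup B G" and D: "subgroup D G"
    and AB: "virtually_contained G A B" and BD: "virtually_contained G B D"
  shows "virtually_contained G A D"
proof -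
  have i: "finite_index_in G (A \<inter> B) A" "finite_index_in G (B \<inter> D) B"
    using AB BD virtually_contained_iff A B D by auto
  have "finite_index_in G ((B \<inter> D) \<inter> (A \<inter> B)) (A \<inter> B)"
    using finite_index_in_Int[OF B subgroups_Inter_pair[OF A B] _ i(2)] by blast
  then have "finite_index_in G ((B \<inter> D) \<inter> (A \<inter> B)) A"
    using finite_index_in_trans[OF A i(1)] by blast
  then show ?thesis unfolding virtually_contained_def by blast
qed

lemma commensurable_iff:
  assumes "subgroup H G" "subgroup K G"
  shows "commensurable G H K \<longleftrightarrow> virtually_contained G H K \<and> virtually_contained G K H"
  using virtually_contained_iff assms unfolding commensurable_def by (simp add: Int_commute)

lemma virtually_contained_refl: "subgroup H G \<Longrightarrow> virtually_contained G H H"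
  using finite_index_in_refl unfolding virtually_contained_def by blast

lemma equiv_commensurability_rel: "equiv {H. subgroup H G} (commensurability_rel G)"
proof (rule equivI)
  show "commensurability_rel G \<subseteq> {H. subgroup H G} \<times> {H. subgroup H G}"
    unfolding commensurability_rel_def by blast
  show "refl_on {H. subgroup H G} (commensurability_rel G)"
    unfolding refl_on_def commensurability_rel_def
    by (auto simp: commensurable_iff virtually_contained_refl)
  show "sym (commensurability_rel G)"
    unfolding sym_def commensurability_rel_def by (auto simp: commensurable_iff)
  show "trans (commensurability_rel G)"
    unfolding trans_def commensurability_rel_def
    by (auto simp: commensurable_iff intro: virtually_contained_trans)
qed

lemma mem_comm_class_iff:
  "subgroup H G \<Longrightarrow> K \<in> comm_class G H \<longleftrightarrow>
     subgroup K G \<and> virtually_contained G H K \<and> virtually_contained G K H"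
  unfolding comm_class_def commensurability_rel_def by (auto simp: commensurable_iff)

lemma carrier_comm_poset: "carrier (comm_poset G) = comm_class G ` {H. subgroup H G}"
  unfolding comm_poset_def comm_class_def quotient_def by auto

lemma comm_poset_le_iff:
  assumes "subgroup H G" "subgroup K G"
  shows "comm_class G H \<sqsubseteq>\<^bsub>comm_poset G\<^esub> comm_class G K \<longleftrightarrow> virtually_contained G H K"
proof
  assume "comm_class G H \<sqsubseteq>\<^bsub>comm_poset G\<^esub> comm_class G K"
  then obtain H' K' where "H' \<in> comm_class G H" "K' \<in> comm_class G K"
    "virtually_contained G H' K'"
    unfolding comm_poset_def by auto
  then show "virtually_contained G H K"
    using assms by (meson mem_comm_class_iff virtually_contained_trans)
next
  assume "virtually_contained G H K"
  moreover have "H \<in> comm_class G H" "K \<in> comm_class G K"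
    using assms by (auto simp: mem_comm_class_iff virtually_contained_refl)
  ultimately show "comm_class G H \<sqsubseteq>\<^bsub>comm_poset G\<^esub> comm_class G K"
    unfolding comm_poset_def by auto
qed

lemma comm_class_eq_iff:
  assumes "subgroup H G" "subgroup K G"
  shows "comm_class G H = comm_class G K \<longleftrightarrow>
           virtually_contained G H K \<and> virtually_contained G K H"
  using eq_equiv_class_iff[OF equiv_commensurability_rel, of H K] assms
  unfolding comm_class_def commensurability_rel_def by (simp add: commensurable_iff)

lemma partial_order_comm_poset: "partial_order (comm_poset G)"
proof -
  have eq: "eq (comm_poset G) = (=)" by (simp add: comm_poset_def)
  show ?thesis
  proof (unfold_locales, unfold eq carrier_comm_poset)
  qed (auto simp: comm_poset_le_iff comm_class_eq_iff mem_comm_class_iff virtually_contained_refl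
        intro: virtually_contained_trans)
qed

end

end

theory Submission
  imports Defs
begin

text \<open>
  Joining \<open>A1\<close> and \<open>A2\<close> as subgroups may give far too much (two finite subgroups can generate an
  infinite group), so the least upper bound is sought among the groups \<open>\<langle>A1, B\<rangle>\<close> with \<open>B\<close> of finite
  index in \<open>A2\<close>. Each of them is an upper bound. Two facts show that one of them is the least.

  First, let \<open>A1\<close> be generated by a finite set \<open>S\<close>. The groups \<open>\<langle>S, B\<rangle>\<close> get smaller with \<open>B\<close>, but from
  some \<open>B\<close> on they stay the same up to finite index (\<open>ex_minimal_generate_Un\<close>). The argument is a
  discrete form of the one with Cayley--Abels graphs: \<open>D = \<langle>S, B\<rangle>\<close> acts on the cosets of \<open>A2\<close>, joined by
  edges labelled by \<open>S\<close>. This graph is locally finite because \<open>A2\<close> is commensurated, so the set of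
  neighbours of the base vertex that \<open>D\<close> can reach by elements of \<open>D \<inter> A2\<close> is finite. Take \<open>B\<close> for
  which it is smallest. A smaller \<open>B'\<close> yields the same neighbours, so, walking along the graph, the
  same orbit of the base vertex; hence \<open>D \<subseteq> A2 \<langle>S, B'\<rangle>\<close>, and \<open>\<langle>S, B'\<rangle>\<close> has finite index in \<open>D\<close>.

  Secondly, replacing \<open>A1\<close> too by a subgroup \<open>B1\<close> of finite index changes nothing:
  \<open>\<langle>B1, B2\<rangle>\<close> virtually contains \<open>\<langle>A1, B\<rangle>\<close> for some \<open>B\<close> of finite index in \<open>A2\<close>
  (\<open>generate_Un_virtually_contained_if_shrink_left\<close>). Indeed \<open>A1\<close> is a finite union of cosets of \<open>B1\<close>, so
  \<open>B\<close> can be chosen such that all its conjugates by elements of \<open>A1\<close> lie in \<open>\<langle>B1, B2\<rangle>\<close>.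

  Any upper bound contains some \<open>\<langle>B1, B2\<rangle>\<close> with both \<open>Bi\<close> of finite index in \<open>Ai\<close>, so when \<open>A1\<close> is
  finitely generated the two facts together give the least upper bound. When \<open>A2\<close> is the finitely
  generated one, this produces \<open>\<langle>B1, A2\<rangle>\<close> instead, and the second fact exchanges it for a group of the
  form \<open>\<langle>A1, B\<rangle>\<close> without enlarging its class. Conjugation preserves the classes of \<open>A1\<close> and \<open>A2\<close>,
  hence that of their join, which is therefore commensurated.
\<close>

context group
begin

section \<open>Virtual containment through cosets\<close>

lemma mult_inv_cancel:
  assumes "a \<in> carrier G" "b \<in> carrier G"
  shows "a \<otimes> (inv a \<otimes> b) = b" "inv a \<otimes> (a \<otimes> b) = b"
  using assms by (simp_all flip: m_assoc)

lemmas group_simps = m_assoc inv_mult_group mult_inv_cancel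

lemma virtually_contained_iff_finite_cosets:
  assumes H: "subgroup H G" and K: "subgroup K G"
  shows "virtually_contained G H K \<longleftrightarrow> finite ((\<lambda>h. K #> h) ` H)"
proof -
  note HK = subgroups_Inter_pair[OF H K]
  have eq: "K #> a = K #> b \<longleftrightarrow> (H \<inter> K) #> a = (H \<inter> K) #> b" if "a \<in> H" "b \<in> H" for a b
  proof -
    have "a \<otimes> inv b \<in> H"
      using that H by (simp add: subgroup.m_closed subgroup.m_inv_closed)
    then show ?thesis
      using r_coset_eq_iff[OF K] r_coset_eq_iff[OF HK] that subgroup.mem_carrier[OF H] by simp
  qed
  have "finite ((\<lambda>h. K #> h) ` H) \<longleftrightarrow> finite ((\<lambda>h. (H \<inter> K) #> h) ` H)"
    using eq by (auto elim!: finite_image_factor)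
  then show ?thesis
    using virtually_contained_iff[OF H K] finite_index_in_iff[OF H] HK by simp
qed

lemma subset_imp_virtually_contained:
  "subgroup H G \<Longrightarrow> H \<subseteq> K \<Longrightarrow> virtually_contained G H K"
  using finite_index_in_refl unfolding virtually_contained_def by blast

lemma finite_index_in_imp_virtually_contained:
  "finite_index_in G K H \<Longrightarrow> virtually_contained G H K"
  unfolding virtually_contained_def by blast

lemma finite_index_in_inter:
  assumes H: "subgroup H G" and K: "finite_index_in G K H" and L: "finite_index_in G L H"
  shows "finite_index_in G (K \<inter> L) H"
proof -
  have "subgroup L G" "L \<subseteq> H" using L finite_index_in_iff[OF H] by auto
  then have "finite_index_in G (K \<inter> L) L" by (rule finite_index_in_Int[OF H _ _ K])
  then show ?thesis by (rule finite_index_in_trans[OF H L])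
qed

text \<open>In place of normality or of a product subgroup it suffices that the set \<open>A Q\<close> covers \<open>L\<close>:
  every coset of \<open>Q\<close> that meets \<open>L\<close> then has a representative in \<open>A\<close>, and \<open>A\<close> meets only
  finitely many of them. The comparisons of generated subgroups below are all obtained in this
  way, because such a cover can be checked one generator at a time.\<close>

lemma virtually_contained_if_covered:
  assumes L: "subgroup L G" and A: "subgroup A G" and Q: "subgroup Q G"
    and AQ: "virtually_contained G A Q"
    and cover: "\<And>l. l \<in> L \<Longrightarrow> \<exists>a\<in>A. \<exists>q\<in>Q. l = a \<otimes> q"
  shows "virtually_contained G L Q"
proof -
  have "(\<lambda>l. Q #> l) ` L \<subseteq> (\<lambda>a. Q #> a) ` A"
  proof
    fix X assume "X \<in> (\<lambda>l. Q #> l) ` L"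
    then obtain l where l: "l \<in> L" "X = Q #> l" by blast
    \<comment> \<open>Inversion turns the cover \<open>A Q\<close> into \<open>Q A\<close>, which fits right cosets.\<close>
    obtain a q where aq: "a \<in> A" "q \<in> Q" "inv l = a \<otimes> q"
      using cover subgroup.m_inv_closed[OF L l(1)] by blast
    have c: "l \<in> carrier G" "a \<in> carrier G" "q \<in> carrier G"
      using l aq L A Q subgroup.mem_carrier by metis+
    have "l = inv q \<otimes> inv a"
      using aq(3) c by (metis inv_inv inv_mult_group)
    then have "l \<otimes> inv (inv a) = inv q" using c by (simp add: m_assoc)
    then have "l \<otimes> inv (inv a) \<in> Q" using aq Q subgroup.m_inv_closed by metis
    then have "Q #> l = Q #> inv a"
      using r_coset_eq_iff[OF Q] c by simp
    then show "X \<in> (\<lambda>a. Q #> a) ` A"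
      using l(2) subgroup.m_inv_closed[OF A aq(1)] by simp
  qed
  then show ?thesis
    using AQ virtually_contained_iff_finite_cosets[OF A Q] virtually_contained_iff_finite_cosets[OF L Q]
    by (simp add: finite_subset)
qed

section \<open>Conjugation\<close>

lemma mem_conjugate_iff:
  assumes "H \<subseteq> carrier G" "c \<in> carrier G"
  shows "x \<in> (c <# H) #> inv c \<longleftrightarrow> x \<in> carrier G \<and> inv c \<otimes> x \<otimes> c \<in> H"
proof
  assume "x \<in> (c <# H) #> inv c"
  then obtain h where "h \<in> H" "x = c \<otimes> h \<otimes> inv c"
    unfolding l_coset_def r_coset_def by blast
  then show "x \<in> carrier G \<and> inv c \<otimes> x \<otimes> c \<in> H"
    using assms by (auto simp: group_simps subsetD)
next
  assume x: "x \<in> carrier G \<and> inv c \<otimes> x \<otimes> c \<in> H"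
  have "x = c \<otimes> (inv c \<otimes> x \<otimes> c) \<otimes> inv c"
    using x assms by (simp add: group_simps)
  then show "x \<in> (c <# H) #> inv c"
    using x unfolding l_coset_def r_coset_def by blast
qed

lemma conjugate_in_conjugate:
  assumes "H \<subseteq> carrier G" "c \<in> carrier G" "h \<in> H"
  shows "c \<otimes> h \<otimes> inv c \<in> (c <# H) #> inv c"
  using assms unfolding l_coset_def r_coset_def by blast

lemma subgroup_conjugate:
  assumes H: "subgroup H G" and c: "c \<in> carrier G"
  shows "subgroup ((c <# H) #> inv c) G"
proof -
  note mem = mem_conjugate_iff[OF subgroup.subset[OF H] c]
  show ?thesis
  proof (rule subgroupI)
    show "(c <# H) #> inv c \<subseteq> carrier G" using mem by blast
    have "\<one> \<in> (c <# H) #> inv c"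
      using c subgroup.one_closed[OF H] unfolding mem by simp
    then show "(c <# H) #> inv c \<noteq> {}" by blast
  next
    fix a assume "a \<in> (c <# H) #> inv c"
    then have a: "a \<in> carrier G" "inv c \<otimes> a \<otimes> c \<in> H" unfolding mem by auto
    have "inv (inv c \<otimes> a \<otimes> c) = inv c \<otimes> inv a \<otimes> c"
      using a c by (simp add: group_simps)
    then show "inv a \<in> (c <# H) #> inv c"
      using a subgroup.m_inv_closed[OF H a(2)] unfolding mem by simp
  next
    fix a b assume "a \<in> (c <# H) #> inv c" "b \<in> (c <# H) #> inv c"
    then have ab: "a \<in> carrier G" "inv c \<otimes> a \<otimes> c \<in> H" "b \<in> carrier G" "inv c \<otimes> b \<otimes> c \<in> H"
      unfolding mem by auto
    have "(inv c \<otimes> a \<otimes> c) \<otimes> (inv c \<otimes> b \<otimes> c) = inv c \<otimes> (a \<otimes> b) \<otimes> c"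
      using ab c by (simp add: group_simps)
    then show "a \<otimes> b \<in> (c <# H) #> inv c"
      using ab subgroup.m_closed[OF H ab(2,4)] unfolding mem by simp
  qed
qed

lemma conjugate_conjugate_inv:
  assumes H: "H \<subseteq> carrier G" and c: "c \<in> carrier G"
  shows "(c <# ((inv c <# H) #> inv (inv c))) #> inv c = H"
proof (rule Set.set_eqI)
  fix x
  let ?H = "(inv c <# H) #> inv (inv c)"
  note inner = mem_conjugate_iff[OF H inv_closed[OF c]]
  have "?H \<subseteq> carrier G" using inner by blast
  then have "x \<in> (c <# ?H) #> inv c \<longleftrightarrow> x \<in> carrier G \<and> inv c \<otimes> x \<otimes> c \<in> ?H"
    using mem_conjugate_iff[OF _ c] by blast
  also have "\<dots> \<longleftrightarrow> x \<in> carrier G \<and> inv (inv c) \<otimes> (inv c \<otimes> x \<otimes> c) \<otimes> inv c \<in> H"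
    using inner[of "inv c \<otimes> x \<otimes> c"] c by auto
  also have "\<dots> \<longleftrightarrow> x \<in> carrier G \<and> x \<in> H"
    using c by (auto simp: group_simps)
  finally show "x \<in> (c <# ?H) #> inv c \<longleftrightarrow> x \<in> H" using H by blast
qed

lemma virtually_contained_conjugate:
  assumes H: "subgroup H G" and K: "subgroup K G" and c: "c \<in> carrier G"
    and HK: "virtually_contained G H K"
  shows "virtually_contained G ((c <# H) #> inv c) ((c <# K) #> inv c)"
proof -
  note K' = subgroup_conjugate[OF K c] and H' = subgroup_conjugate[OF H c]
  have "finite ((\<lambda>h. K #> h) ` H)"
    using HK virtually_contained_iff_finite_cosets[OF H K] by simp
  then have "finite ((\<lambda>h. ((c <# K) #> inv c) #> (c \<otimes> h \<otimes> inv c)) ` H)"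
  proof (rule finite_image_factor)
    fix a b assume ab: "a \<in> H" "b \<in> H" "K #> a = K #> b"
    then have car: "a \<in> carrier G" "b \<in> carrier G" using subgroup.mem_carrier[OF H] by auto
    have "a \<otimes> inv b \<in> K" using ab r_coset_eq_iff[OF K car] by simp
    then have "c \<otimes> (a \<otimes> inv b) \<otimes> inv c \<in> (c <# K) #> inv c"
      using conjugate_in_conjugate[OF subgroup.subset[OF K] c] by blast
    moreover have "c \<otimes> (a \<otimes> inv b) \<otimes> inv c = (c \<otimes> a \<otimes> inv c) \<otimes> inv (c \<otimes> b \<otimes> inv c)"
      using car c by (simp add: group_simps)
    ultimately show "((c <# K) #> inv c) #> (c \<otimes> a \<otimes> inv c) = ((c <# K) #> inv c) #> (c \<otimes> b \<otimes> inv c)"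
      using r_coset_eq_iff[OF K'] car c by simp
  qed
  moreover have "(c <# H) #> inv c = (\<lambda>h. c \<otimes> h \<otimes> inv c) ` H"
    unfolding l_coset_def r_coset_def by blast
  ultimately have "finite ((\<lambda>h. ((c <# K) #> inv c) #> h) ` ((c <# H) #> inv c))"
    by (simp add: image_image)
  then show ?thesis using virtually_contained_iff_finite_cosets[OF H' K'] by blast
qed

lemma commensurated_imp_subgroup: "commensurated G A \<Longrightarrow> subgroup A G"
  unfolding commensurated_def by blast

lemma commensurated_virtually_contained:
  assumes "commensurated G A" "c \<in> carrier G"
  shows "virtually_contained G A ((c <# A) #> inv c)" "virtually_contained G ((c <# A) #> inv c) A"
  using assms commensurable_iff[OF _ subgroup_conjugate, of A A c] unfolding commensurated_def
  by simp_all

text \<open>Conjugating by \<open>c\<close> the containment for \<open>inv c\<close> gives the other half of commensurability.\<close>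

lemma commensuratedI:
  assumes A: "subgroup A G"
    and half: "\<And>c. c \<in> carrier G \<Longrightarrow> virtually_contained G A ((c <# A) #> inv c)"
  shows "commensurated G A"
proof -
  have "virtually_contained G ((c <# A) #> inv c) A" if c: "c \<in> carrier G" for c
    using virtually_contained_conjugate[OF A subgroup_conjugate[OF A inv_closed[OF c]] c
        half[OF inv_closed[OF c]]]
      conjugate_conjugate_inv[OF subgroup.subset[OF A] c] by simp
  then show ?thesis
    unfolding commensurated_def
    using A half commensurable_iff[OF A subgroup_conjugate[OF A]] by simp
qed

lemma commensurated_cong:
  assumes A: "commensurated G A" and B: "subgroup B G"
    and AB: "virtually_contained G A B" and BA: "virtually_contained G B A"
  shows "commensurated G B"
proof (rule commensuratedI[OF B])
  fix c assume c: "c \<in> carrier G"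
  note sA = commensurated_imp_subgroup[OF A]
  note cA = subgroup_conjugate[OF sA c] and cB = subgroup_conjugate[OF B c]
  have "virtually_contained G B ((c <# A) #> inv c)"
    using virtually_contained_trans[OF B sA cA BA] commensurated_virtually_contained[OF A c] by blast
  then show "virtually_contained G B ((c <# B) #> inv c)"
    using virtually_contained_trans[OF B cA cB] virtually_contained_conjugate[OF sA B c AB] by blast
qed

lemma finite_index_in_conjugating_into:
  assumes A: "commensurated G A" and B: "finite_index_in G B A" and c: "c \<in> carrier G"
  shows "\<exists>B'. finite_index_in G B' A \<and> (\<forall>b\<in>B'. c \<otimes> b \<otimes> inv c \<in> B)"
proof -
  note sA = commensurated_imp_subgroup[OF A]
  have sB: "subgroup B G" using B finite_index_in_iff[OF sA] by blast
  have ic: "inv c \<in> carrier G" using c by simp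
  let ?A = "(inv c <# A) #> inv (inv c)" and ?B = "(inv c <# B) #> inv (inv c)"
  have "virtually_contained G ?A ?B"
    using virtually_contained_conjugate[OF sA sB ic] B finite_index_in_imp_virtually_contained by blast
  then have "virtually_contained G A ?B"
    using virtually_contained_trans[OF sA subgroup_conjugate[OF sA ic] subgroup_conjugate[OF sB ic]]
      commensurated_virtually_contained[OF A ic] by blast
  then have "finite_index_in G (A \<inter> ?B) A"
    using virtually_contained_iff[OF sA subgroup_conjugate[OF sB ic]] by blast
  moreover have "c \<otimes> b \<otimes> inv c \<in> B" if "b \<in> A \<inter> ?B" for b
    using that mem_conjugate_iff[OF subgroup.subset[OF sB] ic, of b] c by simp
  ultimately show ?thesis by blast
qed

lemma finite_index_in_conjugating_into_finite:
  assumes A: "commensurated G A" and B: "finite_index_in G B A"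
    and "finite R" "R \<subseteq> carrier G"
  shows "\<exists>B'. finite_index_in G B' A \<and> (\<forall>r\<in>R. \<forall>b\<in>B'. r \<otimes> b \<otimes> inv r \<in> B)"
  using assms(3,4)
proof (induction R rule: finite_induct)
  case empty
  then show ?case using B by blast
next
  case (insert c R)
  then obtain B1 where B1: "finite_index_in G B1 A" "\<forall>r\<in>R. \<forall>b\<in>B1. r \<otimes> b \<otimes> inv r \<in> B"
    by auto
  obtain B2 where B2: "finite_index_in G B2 A" "\<forall>b\<in>B2. c \<otimes> b \<otimes> inv c \<in> B"
    using finite_index_in_conjugating_into[OF A B] insert.prems by blast
  have "finite_index_in G (B1 \<inter> B2) A"
    using finite_index_in_inter[OF commensurated_imp_subgroup[OF A] B1(1) B2(1)] .
  moreover have "\<forall>r\<in>insert c R. \<forall>b\<in>B1 \<inter> B2. r \<otimes> b \<otimes> inv r \<in> B"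
    using B1(2) B2(2) by blast
  ultimately show ?case by blast
qed

section \<open>Generated subgroups\<close>

lemma generate_subset_if_left_closed:
  assumes S: "S \<subseteq> carrier G" and M: "M \<subseteq> carrier G" "\<one> \<in> M"
    and closed: "\<And>s m. s \<in> S \<union> m_inv G ` S \<Longrightarrow> m \<in> M \<Longrightarrow> s \<otimes> m \<in> M"
  shows "generate G S \<subseteq> M"
proof -
  have left: "\<forall>m\<in>M. h \<otimes> m \<in> M" if "h \<in> generate G S" for h
    using that
  proof induction
    case one
    then show ?case using M(1) by (auto simp: subsetD)
  next
    case (incl h)
    then show ?case using closed[of h] by simp
  next
    case (inv h)
    then show ?case using closed[of "inv h"] by simp
  next
    case (eng h1 h2)
    show ?case
    proof
      fix m assume m: "m \<in> M"
      have "h1 \<otimes> h2 \<otimes> m = h1 \<otimes> (h2 \<otimes> m)"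
        using m M(1) generate_in_carrier[OF S] eng.hyps by (simp add: m_assoc subsetD)
      then show "h1 \<otimes> h2 \<otimes> m \<in> M" using eng.IH m by simp
    qed
  qed
  show ?thesis
  proof
    fix h assume h: "h \<in> generate G S"
    then show "h \<in> M" using left[OF h] M(2) generate_in_carrier[OF S h] by fastforce
  qed
qed

lemma generate_Un_generate:
  assumes "S \<subseteq> carrier G" "T \<subseteq> carrier G"
  shows "generate G (generate G S \<union> T) = generate G (S \<union> T)"
proof
  have "generate G S \<union> T \<subseteq> generate G (S \<union> T)"
    using mono_generate[of S "S \<union> T"] by (auto intro: generate.incl)
  then show "generate G (generate G S \<union> T) \<subseteq> generate G (S \<union> T)"
    using generate_subgroup_incl generate_is_subgroup assms by simp
  show "generate G (S \<union> T) \<subseteq> generate G (generate G S \<union> T)"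
    by (rule mono_generate) (auto intro: generate.incl)
qed

text \<open>Schreier's lemma. Left multiplication by a generator maps a coset \<open>inv t \<langle>X\<rangle>\<close> into another one
  \<open>inv t' \<langle>X\<rangle>\<close>, where \<open>X\<close> collects the correction factors. So these cosets cover the group, and an
  element of \<open>K\<close> must lie in one with \<open>t \<in> K\<close>.\<close>

lemma finitely_generated_if_finite_index_in:
  assumes H: "finitely_generated G H" and K: "finite_index_in G K H"
  shows "finitely_generated G K"
proof -
  obtain S where S: "finite S" "S \<subseteq> carrier G" "H = generate G S"
    using H unfolding finitely_generated_def by blast
  have sH: "subgroup H G" using S generate_is_subgroup by simp
  have sK: "subgroup K G" "K \<subseteq> H" and fin: "finite ((\<lambda>a. K #> a) ` H)"
    using K finite_index_in_iff[OF sH] by auto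
  obtain T0 where T0: "T0 \<subseteq> H" "finite T0" "(\<lambda>a. K #> a) ` H = (\<lambda>a. K #> a) ` T0"
    using finite_subset_image[OF fin order_refl] by auto
  let ?T = "insert \<one> T0" and ?S = "S \<union> m_inv G ` S"
  have T: "?T \<subseteq> H" "finite ?T" using T0 subgroup.one_closed[OF sH] by auto
  have Tc: "?T \<subseteq> carrier G" using T subgroup.subset[OF sH] by blast
  have Sc: "?S \<subseteq> carrier G" "?S \<subseteq> H" "finite ?S"
    using S by (auto intro: generate.intros)
  \<comment> \<open>The products with a factor from \<open>?S\<close> are Schreier's generators. Those with the factor \<open>\<one>\<close>
    provide the elements of \<open>?T \<inter> K\<close>: adjoining \<open>\<one>\<close> to \<open>T0\<close> may have given \<open>K\<close> a second
    representative.\<close>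
  define X where "X = (\<lambda>(t, s, t'). t \<otimes> s \<otimes> inv t') ` (?T \<times> insert \<one> ?S \<times> ?T) \<inter> K"
  have X: "X \<subseteq> K" unfolding X_def by (rule Int_lower2)
  have finX: "finite X"
    unfolding X_def using T(2) Sc(3) by (intro finite_Int disjI1 finite_imageI finite_SigmaI) simp_all
  have Xc: "X \<subseteq> carrier G" using X subgroup.subset[OF sK(1)] by (rule order_trans)
  have gXK: "generate G X \<subseteq> K" using generate_subgroup_incl[OF X sK(1)] .
  have rep: "\<exists>t\<in>?T. h \<otimes> inv t \<in> K" if "h \<in> H" for h
  proof -
    have "K #> h \<in> (\<lambda>a. K #> a) ` T0" using imageI[OF that, of "\<lambda>a. K #> a"] T0(3) by simp
    then obtain t where "t \<in> T0" "K #> h = K #> t" by (rule imageE)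
    moreover from this have "h \<otimes> inv t \<in> K"
      using r_coset_eq_iff[OF sK(1), of h t] subgroup.mem_carrier[OF sH that] Tc by auto
    ultimately show ?thesis by blast
  qed
  let ?M = "{inv t \<otimes> x | t x. t \<in> ?T \<and> x \<in> generate G X}"
  have "generate G S \<subseteq> ?M"
  proof (rule generate_subset_if_left_closed[OF S(2)])
    show "?M \<subseteq> carrier G" using Tc generate_in_carrier[OF Xc] by auto
    have "inv \<one> \<otimes> \<one> \<in> ?M" using generate.one[of G X] by blast
    then show "\<one> \<in> ?M" by simp
  next
    fix s m assume s: "s \<in> ?S" and "m \<in> ?M"
    then obtain t x where tx: "t \<in> ?T" "x \<in> generate G X" "m = inv t \<otimes> x" by blast
    have invs: "inv s \<in> ?S" using s S(2) by auto
    have car: "s \<in> carrier G" "t \<in> carrier G" "x \<in> carrier G"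
      using s Sc(1) tx Tc generate_in_carrier[OF Xc] by auto
    have tH: "t \<otimes> inv s \<in> H"
      using tx(1) T(1) invs Sc(2) by (intro subgroup.m_closed[OF sH]) auto
    then obtain t' where t': "t' \<in> ?T" "t \<otimes> inv s \<otimes> inv t' \<in> K" using rep by blast
    have t'c: "t' \<in> carrier G" using t' Tc by blast
    have "t \<otimes> inv s \<otimes> inv t' \<in> X"
      unfolding X_def using t' tx(1) invs
      by (intro IntI image_eqI[where x = "(t, inv s, t')"] SigmaI insertI2[of "inv s"]) simp_all
    then have "inv (t \<otimes> inv s \<otimes> inv t') \<in> generate G X" by (rule generate.inv)
    then have "inv (t \<otimes> inv s \<otimes> inv t') \<otimes> x \<in> generate G X" using tx(2) by (rule generate.eng)
    moreover have "s \<otimes> m = inv t' \<otimes> (inv (t \<otimes> inv s \<otimes> inv t') \<otimes> x)"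
      using tx(3) car t'c by (simp add: group_simps)
    ultimately show "s \<otimes> m \<in> ?M" using t'(1) by blast
  qed
  have "K \<subseteq> generate G X"
  proof
    fix k assume k: "k \<in> K"
    then obtain t x where tx: "t \<in> ?T" "x \<in> generate G X" "k = inv t \<otimes> x"
      using \<open>generate G S \<subseteq> ?M\<close> sK(2) S(3) by blast
    have car: "t \<in> carrier G" "x \<in> carrier G" "k \<in> carrier G"
      using tx Tc generate_in_carrier[OF Xc] k subgroup.mem_carrier[OF sK(1)] by auto
    have "t = x \<otimes> inv k" using tx(3) car by (simp add: group_simps)
    then have "t \<in> K"
      using gXK tx(2) k sK(1) by (auto simp: subgroup.m_closed subgroup.m_inv_closed subsetD)
    then have "t \<otimes> \<one> \<otimes> inv \<one> \<in> X"
      unfolding X_def using tx(1) car by (intro IntI image_eqI[where x = "(t, \<one>, \<one>)"]) auto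
    then have "inv t \<in> generate G X" using car generate.inv[of t X] by simp
    then show "k \<in> generate G X" using tx by (auto intro: generate.eng)
  qed
  then show ?thesis
    using gXK finX Xc unfolding finitely_generated_def by blast
qed

section \<open>Shrinking the generators of a join\<close>

text \<open>With \<open>Q = \<langle>B1, B2\<rangle>\<close>, the set \<open>A1 Q\<close> is stable under left multiplication by \<open>b\<close> as soon as \<open>Q\<close>
  contains the conjugates of \<open>b\<close> by \<open>A1\<close>. As \<open>B1 \<subseteq> Q\<close>, only conjugates by representatives of
  the finitely many cosets of \<open>B1\<close> matter, and these can all be put into \<open>B2\<close> because \<open>A2\<close> is
  commensurated.\<close>

lemma generate_Un_virtually_contained_if_shrink_left:
  assumes A1: "subgroup A1 G" and A2: "commensurated G A2"
    and B1: "finite_index_in G B1 A1" and B2: "finite_index_in G B2 A2"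
  shows "\<exists>B. finite_index_in G B A2 \<and>
           virtually_contained G (generate G (A1 \<union> B)) (generate G (B1 \<union> B2))"
proof -
  note sA2 = commensurated_imp_subgroup[OF A2]
  have sB1: "subgroup B1 G" "B1 \<subseteq> A1" and fin: "finite ((\<lambda>a. B1 #> a) ` A1)"
    using B1 finite_index_in_iff[OF A1] by auto
  have sB2: "subgroup B2 G" using B2 finite_index_in_iff[OF sA2] by auto
  have A1c: "A1 \<subseteq> carrier G" using subgroup.subset[OF A1] .
  obtain R where R: "R \<subseteq> A1" "finite R" "(\<lambda>a. B1 #> a) ` A1 = (\<lambda>a. B1 #> a) ` R"
    using finite_subset_image[OF fin order_refl] by auto
  obtain B where B: "finite_index_in G B A2" "\<forall>r\<in>R. \<forall>b\<in>B. r \<otimes> b \<otimes> inv r \<in> B2"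
    using finite_index_in_conjugating_into_finite[OF A2 B2 R(2)] R(1) A1c by blast
  have sB: "subgroup B G" using B finite_index_in_iff[OF sA2] by auto
  let ?Q = "generate G (B1 \<union> B2)" and ?L = "generate G (A1 \<union> B)"
  have Q: "subgroup ?Q G" "B1 \<subseteq> ?Q" "B2 \<subseteq> ?Q"
    using sB1 sB2 by (auto intro!: generate_is_subgroup intro: generate.incl dest: subgroup.subset)
  have gens: "A1 \<union> B \<subseteq> carrier G" using A1c subgroup.subset[OF sB] by blast
  \<comment> \<open>Writing \<open>inv a = b1 \<otimes> r\<close> reduces this to the finitely many representatives \<open>r\<close>.\<close>
  have conj: "inv a \<otimes> b \<otimes> a \<in> ?Q" if a: "a \<in> A1" and b: "b \<in> B" for a b
  proof -
    have ia: "inv a \<in> A1" using subgroup.m_inv_closed[OF A1 a] .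
    then obtain r where r: "r \<in> R" "B1 #> inv a = B1 #> r" using R(3) by blast
    have car: "a \<in> carrier G" "r \<in> carrier G" "b \<in> carrier G"
      using a r R(1) A1c b subgroup.subset[OF sB] by auto
    have k: "inv a \<otimes> inv r \<in> ?Q"
      using r_coset_eq_iff[OF sB1(1)] r(2) car Q(2) by auto
    have "r \<otimes> b \<otimes> inv r \<in> ?Q" using B(2) r(1) b Q(3) by blast
    then have "(inv a \<otimes> inv r) \<otimes> (r \<otimes> b \<otimes> inv r) \<otimes> inv (inv a \<otimes> inv r) \<in> ?Q"
      using k Q(1) by (simp add: subgroup.m_closed subgroup.m_inv_closed)
    moreover have "(inv a \<otimes> inv r) \<otimes> (r \<otimes> b \<otimes> inv r) \<otimes> inv (inv a \<otimes> inv r) = inv a \<otimes> b \<otimes> a"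
      using car by (simp add: group_simps)
    ultimately show ?thesis by simp
  qed
  let ?M = "{a \<otimes> q | a q. a \<in> A1 \<and> q \<in> ?Q}"
  have Qc: "?Q \<subseteq> carrier G" using subgroup.subset[OF Q(1)] .
  have "?L \<subseteq> ?M"
  proof (rule generate_subset_if_left_closed[OF gens])
    show "?M \<subseteq> carrier G" using A1c Qc by auto
    have "\<one> \<otimes> \<one> \<in> ?M" using subgroup.one_closed[OF A1] subgroup.one_closed[OF Q(1)] by blast
    then show "\<one> \<in> ?M" by simp
  next
    fix s m assume s: "s \<in> (A1 \<union> B) \<union> m_inv G ` (A1 \<union> B)" and "m \<in> ?M"
    then obtain a q where aq: "a \<in> A1" "q \<in> ?Q" "m = a \<otimes> q" by blast
    have car: "a \<in> carrier G" "q \<in> carrier G" using aq A1c Qc by auto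
    have "s \<in> A1 \<union> B" using s A1 sB by (auto simp: subgroup.m_inv_closed)
    then show "s \<otimes> m \<in> ?M"
    proof
      assume s: "s \<in> A1"
      then have "s \<otimes> m = (s \<otimes> a) \<otimes> q" using aq car A1c by (simp add: m_assoc subsetD)
      moreover have "s \<otimes> a \<in> A1" using s aq subgroup.m_closed[OF A1] by blast
      ultimately show ?thesis using aq by blast
    next
      assume s: "s \<in> B"
      then have "s \<in> carrier G" using subgroup.subset[OF sB] by blast
      then have "s \<otimes> m = a \<otimes> ((inv a \<otimes> s \<otimes> a) \<otimes> q)"
        using aq car by (simp add: group_simps)
      moreover have "(inv a \<otimes> s \<otimes> a) \<otimes> q \<in> ?Q"
        using conj[OF aq(1) s] aq(2) by (rule generate.eng)
      ultimately show ?thesis using aq by blast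
    qed
  qed
  moreover have "virtually_contained G A1 ?Q"
    using B1 Q(2) unfolding virtually_contained_def by blast
  ultimately have "virtually_contained G ?L ?Q"
    using virtually_contained_if_covered[OF generate_is_subgroup[OF gens] A1 Q(1)] by blast
  then show ?thesis using B(1) by blast
qed

text \<open>The local finiteness of the coset graph: the double coset \<open>A s A\<close> is a finite union of right
  cosets of \<open>A\<close>.\<close>

lemma commensurated_finite_cosets:
  assumes A: "commensurated G A" and s: "s \<in> carrier G"
  shows "finite ((\<lambda>e. A #> (s \<otimes> e)) ` A)"
proof -
  note sA = commensurated_imp_subgroup[OF A]
  obtain B where B: "finite_index_in G B A" "\<forall>b\<in>B. s \<otimes> b \<otimes> inv s \<in> A"
    using finite_index_in_conjugating_into[OF A finite_index_in_refl[OF sA] s] by blast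
  then have sB: "subgroup B G" and "finite ((\<lambda>e. B #> e) ` A)"
    using finite_index_in_iff[OF sA] by auto
  from this(2) show ?thesis
  proof (rule finite_image_factor)
    fix a b assume ab: "a \<in> A" "b \<in> A" "B #> a = B #> b"
    then have car: "a \<in> carrier G" "b \<in> carrier G" using subgroup.mem_carrier[OF sA] by auto
    have "a \<otimes> inv b \<in> B" using ab r_coset_eq_iff[OF sB car] by simp
    then have "s \<otimes> (a \<otimes> inv b) \<otimes> inv s \<in> A" using B(2) by blast
    moreover have "s \<otimes> (a \<otimes> inv b) \<otimes> inv s = (s \<otimes> a) \<otimes> inv (s \<otimes> b)"
      using s car by (simp add: group_simps)
    ultimately show "A #> (s \<otimes> a) = A #> (s \<otimes> b)"
      using r_coset_eq_iff[OF sA] s car by simp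
  qed
qed

text \<open>The group \<open>\<langle>S, B\<rangle>\<close> is controlled by the finite set \<open>N B\<close> of cosets of \<open>A\<close> that are neighbours of \<open>A\<close>
  itself and reached through the part of \<open>\<langle>S, B\<rangle>\<close> in \<open>A\<close>. Choosing \<open>B\<close> with \<open>card (N B)\<close> least makes
  \<open>N B\<close> constant under further shrinking, and equality of these sets suffices to carry
  an element of \<open>\<langle>S, B\<rangle>\<close> into a product from \<open>A\<close> and \<open>\<langle>S, B'\<rangle>\<close>, letter by letter.\<close>

lemma ex_minimal_generate_Un:
  assumes S: "finite S" "S \<subseteq> carrier G" and A: "commensurated G A"
  shows "\<exists>B. finite_index_in G B A \<and>
           (\<forall>B'. finite_index_in G B' A \<longrightarrow>
              virtually_contained G (generate G (S \<union> B)) (generate G (S \<union> B')))"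
proof -
  note sA = commensurated_imp_subgroup[OF A]
  let ?T = "S \<union> m_inv G ` S"
  have Tc: "?T \<subseteq> carrier G" using S by auto
  define N where
    "N B = (\<Union>s\<in>?T. (\<lambda>e. A #> (s \<otimes> e)) ` (generate G (S \<union> B) \<inter> A))" for B
  have finN: "finite (N B)" for B
  proof -
    have "finite ((\<lambda>e. A #> (s \<otimes> e)) ` (generate G (S \<union> B) \<inter> A))" if "s \<in> ?T" for s
      using that Tc by (intro finite_subset[OF _ commensurated_finite_cosets[OF A, of s]]) auto
    then show ?thesis unfolding N_def using S(1) by blast
  qed
  obtain B where B: "finite_index_in G B A"
    and min: "\<And>B'. finite_index_in G B' A \<Longrightarrow> card (N B) \<le> card (N B')"
    using ex_has_least_nat[of "\<lambda>B. finite_index_in G B A" A "\<lambda>B. card (N B)"]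
      finite_index_in_refl[OF sA] by blast
  have "virtually_contained G (generate G (S \<union> B)) (generate G (S \<union> B'))"
    if B': "finite_index_in G B' A" for B'
  proof -
    \<comment> \<open>\<open>B'\<close> need not lie in \<open>B\<close>, so it is replaced by the intersection.\<close>
    define B0 where "B0 = B \<inter> B'"
    have B0: "finite_index_in G B0 A"
      unfolding B0_def using finite_index_in_inter[OF sA B B'] .
    let ?D = "generate G (S \<union> B)" and ?E = "generate G (S \<union> B0)"
    have sub: "subgroup B G" "B \<subseteq> A" "subgroup B0 G"
      using B B0 finite_index_in_iff[OF sA] by auto
    have gens: "S \<union> B \<subseteq> carrier G" "S \<union> B0 \<subseteq> carrier G"
      using S sub by (auto dest: subgroup.subset)
    note D = generate_is_subgroup[OF gens(1)] and D0 = generate_is_subgroup[OF gens(2)]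
    have D0D: "?E \<subseteq> ?D" unfolding B0_def by (rule mono_generate) auto
    have "N B0 \<subseteq> N B" unfolding N_def using D0D by blast
    then have N: "N B0 = N B" using card_seteq[OF finN] min[OF B0] by blast
    have TD0: "?T \<subseteq> ?E" by (auto intro: generate.intros)
    let ?M = "{f \<otimes> d | f d. f \<in> ?D \<inter> A \<and> d \<in> ?E}"
    note DA = subgroups_Inter_pair[OF D sA]
    have "?D \<subseteq> ?M"
    proof (rule generate_subset_if_left_closed[OF gens(1)])
      show "?M \<subseteq> carrier G" using subgroup.subset[OF DA] subgroup.subset[OF D0] by auto
      have "\<one> \<otimes> \<one> \<in> ?M" using subgroup.one_closed[OF DA] subgroup.one_closed[OF D0] by blast
      then show "\<one> \<in> ?M" by simp
    next
      fix s m assume s: "s \<in> (S \<union> B) \<union> m_inv G ` (S \<union> B)" and "m \<in> ?M"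
      then obtain e d where ed: "e \<in> ?D \<inter> A" "d \<in> ?E" "m = e \<otimes> d" by blast
      have car: "e \<in> carrier G" "d \<in> carrier G"
        using ed subgroup.mem_carrier[OF sA] subgroup.mem_carrier[OF D0] by auto
      have "s \<in> ?T \<or> s \<in> B" using s sub(1) by (auto simp: subgroup.m_inv_closed)
      then show "s \<otimes> m \<in> ?M"
      proof
        assume s: "s \<in> B"
        then have "s \<in> ?D \<inter> A" using sub(2) by (auto intro: generate.incl)
        then have "s \<otimes> e \<in> ?D \<inter> A" using ed(1) subgroup.m_closed[OF DA] by blast
        moreover have "s \<otimes> m = (s \<otimes> e) \<otimes> d"
          using s ed(3) car subgroup.mem_carrier[OF sub(1)] by (simp add: m_assoc)
        ultimately show ?thesis using ed(2) by blast
      next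
        assume s: "s \<in> ?T"
        then have "A #> (s \<otimes> e) \<in> N B" unfolding N_def using ed(1) by blast
        then have "A #> (s \<otimes> e) \<in> N B0" unfolding N .
        then obtain s' e' where s': "s' \<in> ?T" "e' \<in> ?E \<inter> A" "A #> (s \<otimes> e) = A #> (s' \<otimes> e')"
          unfolding N_def by (elim UN_E imageE)
        have car': "s \<in> carrier G" "s' \<in> carrier G" "e' \<in> carrier G"
          using s s' Tc subgroup.mem_carrier[OF sA] by auto
        \<comment> \<open>The letter \<open>s\<close> is traded for \<open>s'\<close>, which leaves the error \<open>f\<close> in \<open>A\<close> on the left.\<close>
        define f where "f = (s \<otimes> e) \<otimes> inv (s' \<otimes> e')"
        have se': "s' \<otimes> e' \<in> ?E" using s' TD0 subgroup.m_closed[OF D0] by blast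
        have "f \<in> A" unfolding f_def using r_coset_eq_iff[OF sA] s'(3) car car' by simp
        moreover have "s \<otimes> e \<in> ?D" using s TD0 D0D ed(1) subgroup.m_closed[OF D] by blast
        then have "f \<in> ?D"
          unfolding f_def using se' D0D D by (meson subgroup.m_closed subgroup.m_inv_closed subsetD)
        moreover have "(s' \<otimes> e') \<otimes> d \<in> ?E" using se' ed(2) subgroup.m_closed[OF D0] by blast
        moreover have "s \<otimes> m = f \<otimes> ((s' \<otimes> e') \<otimes> d)"
          unfolding f_def using ed(3) car car' by (simp add: group_simps)
        ultimately show ?thesis by blast
      qed
    qed
    moreover have "virtually_contained G A ?E"
      using B0 unfolding virtually_contained_def by (auto intro: generate.incl)
    ultimately have "virtually_contained G ?D ?E"
      using virtually_contained_if_covered[OF D sA D0] by blast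
    moreover have "?E \<subseteq> generate G (S \<union> B')" unfolding B0_def by (rule mono_generate) auto
    ultimately show ?thesis unfolding virtually_contained_def by blast
  qed
  then show ?thesis using B by blast
qed

section \<open>The join of two commensurability classes\<close>

lemma ex_least_join_if_left_finitely_generated:
  assumes A1: "finitely_generated G A1" and A2: "commensurated G A2"
  shows "\<exists>B. finite_index_in G B A2 \<and>
           (\<forall>D. subgroup D G \<longrightarrow> virtually_contained G A1 D \<longrightarrow> virtually_contained G A2 D \<longrightarrow>
              virtually_contained G (generate G (A1 \<union> B)) D)"
proof -
  note sA2 = commensurated_imp_subgroup[OF A2]
  obtain S where S: "finite S" "S \<subseteq> carrier G" "A1 = generate G S"
    using A1 unfolding finitely_generated_def by blast
  have sA1: "subgroup A1 G" using S generate_is_subgroup by simp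
  have gen: "generate G (S \<union> B) = generate G (A1 \<union> B)" "subgroup (generate G (A1 \<union> B)) G"
    if "finite_index_in G B A2" for B
  proof -
    have "B \<subseteq> carrier G"
      using that finite_index_in_iff[OF sA2] subgroup.subset by blast
    then show "generate G (S \<union> B) = generate G (A1 \<union> B)" "subgroup (generate G (A1 \<union> B)) G"
      using generate_Un_generate S generate_is_subgroup subgroup.subset[OF sA1] by auto
  qed
  obtain B where B: "finite_index_in G B A2"
    and min: "\<And>B'. finite_index_in G B' A2 \<Longrightarrow>
      virtually_contained G (generate G (A1 \<union> B)) (generate G (A1 \<union> B'))"
    using ex_minimal_generate_Un[OF S(1,2) A2] gen(1) by metis
  have "virtually_contained G (generate G (A1 \<union> B)) D"
    if D: "subgroup D G" "virtually_contained G A1 D" "virtually_contained G A2 D" for D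
  proof -
    have "finite_index_in G (A1 \<inter> D) A1" "finite_index_in G (A2 \<inter> D) A2"
      using D virtually_contained_iff sA1 sA2 by auto
    then obtain B' where B': "finite_index_in G B' A2"
      "virtually_contained G (generate G (A1 \<union> B')) (generate G ((A1 \<inter> D) \<union> (A2 \<inter> D)))"
      using generate_Un_virtually_contained_if_shrink_left[OF sA1 A2] by blast
    moreover have "generate G ((A1 \<inter> D) \<union> (A2 \<inter> D)) \<subseteq> D"
      using generate_subgroup_incl D(1) by simp
    ultimately have "virtually_contained G (generate G (A1 \<union> B')) D"
      unfolding virtually_contained_def by blast
    then show ?thesis
      using virtually_contained_trans[OF gen(2)[OF B] gen(2)[OF B'(1)] D(1) min[OF B'(1)]] by blast
  qed
  then show ?thesis using B by blast
qed

text \<open>If \<open>A2\<close> is the finitely generated one, the roles are exchanged, which shrinks \<open>A1\<close> to \<open>B1\<close>. The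
  group \<open>\<langle>A1, B\<rangle>\<close> then restores the whole of \<open>A1\<close> and is still virtually contained in the join.\<close>

lemma ex_least_join:
  assumes A1: "commensurated G A1" and A2: "commensurated G A2"
    and fg: "finitely_generated G A1 \<or> finitely_generated G A2"
  shows "\<exists>B. finite_index_in G B A2 \<and>
           (\<forall>D. subgroup D G \<longrightarrow> virtually_contained G A1 D \<longrightarrow> virtually_contained G A2 D \<longrightarrow>
              virtually_contained G (generate G (A1 \<union> B)) D)"
  using fg
proof
  assume "finitely_generated G A1"
  then show ?thesis using ex_least_join_if_left_finitely_generated[OF _ A2] by blast
next
  note sA1 = commensurated_imp_subgroup[OF A1] and sA2 = commensurated_imp_subgroup[OF A2]
  assume "finitely_generated G A2"
  then obtain B1 where B1: "finite_index_in G B1 A1"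
    and least: "\<And>D. subgroup D G \<Longrightarrow> virtually_contained G A1 D \<Longrightarrow> virtually_contained G A2 D \<Longrightarrow>
      virtually_contained G (generate G (A2 \<union> B1)) D"
    using ex_least_join_if_left_finitely_generated[OF _ A1] by blast
  obtain B where B: "finite_index_in G B A2"
    and vc: "virtually_contained G (generate G (A1 \<union> B)) (generate G (B1 \<union> A2))"
    using generate_Un_virtually_contained_if_shrink_left[OF sA1 A2 B1 finite_index_in_refl[OF sA2]]
    by blast
  have "B1 \<subseteq> carrier G" "A1 \<subseteq> carrier G" "A2 \<subseteq> carrier G" "B \<subseteq> carrier G"
    using B B1 finite_index_in_iff sA1 sA2 subgroup.subset by blast+
  then have sub: "subgroup (generate G (A1 \<union> B)) G" "subgroup (generate G (B1 \<union> A2)) G"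
    by (simp_all add: generate_is_subgroup)
  have "virtually_contained G (generate G (A1 \<union> B)) D"
    if "subgroup D G" "virtually_contained G A1 D" "virtually_contained G A2 D" for D
    using virtually_contained_trans[OF sub that(1) vc] least[OF that] by (simp add: Un_commute)
  then show ?thesis using B by blast
qed

text \<open>A conjugate of the least upper bound is an upper bound of conjugates of \<open>A1\<close> and \<open>A2\<close>, and so of
  \<open>A1\<close> and \<open>A2\<close> themselves.\<close>

lemma commensurated_if_least_upper_bound:
  assumes A1: "commensurated G A1" and A2: "commensurated G A2" and A: "subgroup A G"
    and ub: "virtually_contained G A1 A" "virtually_contained G A2 A"
    and least: "\<And>D. subgroup D G \<Longrightarrow> virtually_contained G A1 D \<Longrightarrow> virtually_contained G A2 D \<Longrightarrow>
      virtually_contained G A D"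
  shows "commensurated G A"
proof (rule commensuratedI[OF A])
  fix c assume c: "c \<in> carrier G"
  have "virtually_contained G A' ((c <# A) #> inv c)"
    if A': "commensurated G A'" "virtually_contained G A' A" for A'
    using virtually_contained_conjugate[OF _ A c that(2)] commensurated_virtually_contained(1)[OF A'(1) c]
      virtually_contained_trans subgroup_conjugate c A commensurated_imp_subgroup[OF A'(1)] by meson
  then show "virtually_contained G A ((c <# A) #> inv c)"
    using least[OF subgroup_conjugate[OF A c]] A1 A2 ub by blast
qed

end

theorem corollary3p6:
  fixes C :: "('a, 'b) monoid_scheme" and A\<^sub>1 A\<^sub>2 :: "'a set"
  assumes "group C"
    and "commensurated C A\<^sub>1" and "commensurated C A\<^sub>2"
    and "finitely_generated C A\<^sub>1 \<or> finitely_generated C A\<^sub>2"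
  shows "\<exists>J. is_lub (comm_poset C) J {comm_class C A\<^sub>1, comm_class C A\<^sub>2} \<and>
           (\<forall>B\<in>J. commensurated C B) \<and>
           (\<exists>A. subgroup A C \<and> comm_class C A = J \<and>
              A = generate C (A\<^sub>1 \<union> (A\<^sub>2 \<inter> A)) \<and>
              (finitely_generated C A\<^sub>1 \<and> finitely_generated C A\<^sub>2 \<longrightarrow> finitely_generated C A))"
proof -
  interpret group C by fact
  note s1 = commensurated_imp_subgroup[OF assms(2)] and s2 = commensurated_imp_subgroup[OF assms(3)]
  obtain B where B: "finite_index_in C B A\<^sub>2"
    and least: "\<And>D. subgroup D C \<Longrightarrow> virtually_contained C A\<^sub>1 D \<Longrightarrow> virtually_contained C A\<^sub>2 D \<Longrightarrow>
      virtually_contained C (generate C (A\<^sub>1 \<union> B)) D"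
    using ex_least_join[OF assms(2-4)] by blast
  have sB: "subgroup B C" "B \<subseteq> A\<^sub>2" using B finite_index_in_iff[OF s2] by auto
  define A where "A = generate C (A\<^sub>1 \<union> B)"
  have A: "subgroup A C"
    unfolding A_def using s1 sB by (auto intro!: generate_is_subgroup dest: subgroup.subset)
  have sub: "A\<^sub>1 \<subseteq> A" "B \<subseteq> A" unfolding A_def by (auto intro: generate.incl)
  have ub: "virtually_contained C A\<^sub>1 A" "virtually_contained C A\<^sub>2 A"
    using subset_imp_virtually_contained[OF s1 sub(1)] B sub(2) unfolding virtually_contained_def
    by blast+
  note comm = commensurated_if_least_upper_bound[OF assms(2,3) A ub least[folded A_def]]
  have lub: "is_lub (comm_poset C) (comm_class C A) {comm_class C A\<^sub>1, comm_class C A\<^sub>2}"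
  proof (rule least_UpperI)
    fix x assume "x \<in> {comm_class C A\<^sub>1, comm_class C A\<^sub>2}"
    then show "x \<sqsubseteq>\<^bsub>comm_poset C\<^esub> comm_class C A"
      using ub comm_poset_le_iff s1 s2 A by auto
  next
    fix y assume y: "y \<in> Upper (comm_poset C) {comm_class C A\<^sub>1, comm_class C A\<^sub>2}"
    have car: "{comm_class C A\<^sub>1, comm_class C A\<^sub>2} \<subseteq> carrier (comm_poset C)"
      using s1 s2 by (auto simp: carrier_comm_poset)
    have "y \<in> carrier (comm_poset C)" using y by (auto simp: Upper_def)
    then obtain D where D: "subgroup D C" "y = comm_class C D"
      by (auto simp: carrier_comm_poset)
    have "comm_class C A\<^sub>1 \<sqsubseteq>\<^bsub>comm_poset C\<^esub> y" "comm_class C A\<^sub>2 \<sqsubseteq>\<^bsub>comm_poset C\<^esub> y"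
      using Upper_memD[OF y _ car] by auto
    then show "comm_class C A \<sqsubseteq>\<^bsub>comm_poset C\<^esub> y"
      using least[folded A_def, OF D(1)] D comm_poset_le_iff s1 s2 A by auto
  qed (use s1 s2 A in \<open>auto simp: carrier_comm_poset\<close>)
  have cls: "\<forall>B\<in>comm_class C A. commensurated C B"
    using commensurated_cong[OF comm] mem_comm_class_iff[OF A] by blast
  have form: "A = generate C (A\<^sub>1 \<union> (A\<^sub>2 \<inter> A))"
  proof
    have "A\<^sub>1 \<union> B \<subseteq> A\<^sub>1 \<union> (A\<^sub>2 \<inter> A)" using sub sB(2) by blast
    from mono_generate[OF this] show "A \<subseteq> generate C (A\<^sub>1 \<union> (A\<^sub>2 \<inter> A))"
      unfolding A_def[symmetric] .
    have "A\<^sub>1 \<union> (A\<^sub>2 \<inter> A) \<subseteq> A" using sub(1) by blast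
    then show "generate C (A\<^sub>1 \<union> (A\<^sub>2 \<inter> A)) \<subseteq> A" using A by (rule generate_subgroup_incl)
  qed
  have fg: "finitely_generated C A" if fgs: "finitely_generated C A\<^sub>1" "finitely_generated C A\<^sub>2"
  proof -
    obtain S T where "finite S" "S \<subseteq> carrier C" "A\<^sub>1 = generate C S"
      and "finite T" "T \<subseteq> carrier C" "B = generate C T"
      using fgs(1) finitely_generated_if_finite_index_in[OF fgs(2) B]
      unfolding finitely_generated_def by blast
    moreover from this have "A = generate C (S \<union> T)"
      unfolding A_def using generate_Un_generate[of S "generate C T"] generate_Un_generate[of T S]
      by (simp add: Un_commute generate_incl)
    ultimately show ?thesis unfolding finitely_generated_def by blast
  qed
  show ?thesis using lub cls A form fg by blast
qed

end
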